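(* Let $(X,d)$ be a metric space satisfying the uniform betweenness property with modulus of uniform betweenness $\Theta:(0,\infty)^3\to(0,\infty)$. Let $b\in\mathbb{R}$ satisfy $b\ge \operatorname{diam}(X)>0$, let $D>0$, and let $N\in\mathbb{N}$ be such that $b+1<ND$. Put $\Theta_b(\varepsilon):=\Theta(\varepsilon,\varepsilon,b)$ for $\varepsilon>0$ and assume $\Theta_b(\varepsilon)\le\varepsilon$ for all $\varepsilon>0$. Let $\langle (M_n),(L_n)\rangle$ be a Lion-Man game in $X$ with speed $D$. Then for every $\varepsilon>0$, every $\alpha$ with $$0<\alpha\le\min\left\{\frac1N,\frac{\varepsilon}{2},\frac D2\right\},$$ and every integer $$n\ \ge\ N+N\left\lceil \frac{b}{\Theta_b^{(N)}(\alpha)}\right\rceil ,$$ where $\Theta_b^{(N)}$ is the $N$-fold composition of $\Theta_b$ with itself, we have $$d(L_{n+1},M_n)<\varepsilon .$$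
   Context: Uniform betweenness property: a metric space $(X,d)$ satisfies it if for all $a,b,\varepsilon>0$ there is $\theta>0$ such that for all $x,y,z,w\in X$: if $\operatorname{sep}\{x,y,z,w\}\ge a$, $\operatorname{diam}\{x,y,z,w\}\le b$, $d(x,y)+d(y,z)\le d(x,z)+\theta$ and $d(y,z)+d(z,w)\le d(y,w)+\theta$, then $d(x,z)+d(z,w)\le d(x,w)+\varepsilon$. Here $\operatorname{diam}\{x,y,z,w\}$ is the largest of the pairwise distances, and $\operatorname{sep}\{x,y,z,w\}\ge a$ means that the four points are pairwise distinct and all six pairwise distances are $\ge a$. A function $\Theta:(0,\infty)^3\to(0,\infty)$ such that $\theta=\Theta(\varepsilon,a,b)$ works for all $\varepsilon,a,b>0$ is called a modulus of uniform betweenness (note the order of arguments $(\varepsilon,a,b)$). Lion-Man game with speed $D>0$ in a metric space $(X,d)$: a pair $\langle (M_n),(L_n)\rangle$ of sequences in $X$ (indexed by $n=0,1,2,\dots$) such that for all $n$: $d(M_n,M_{n+1})\le D$, $d(L_{n+1},L_n)+d(L_{n+1},M_n)=d(L_n,M_n)$, and $d(L_n,L_{n+1})=\min\{D,d(L_n,M_n)\}$. *)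

theory Defs
  imports "HOL-Analysis.Analysis"
begin

text \<open>A metric space is a set \<open>X\<close> of points of a type of class \<open>metric_space\<close>, with the induced
  metric; the whole type is the case \<open>X = UNIV\<close>.\<close>

definition sep4_ge :: "'a::metric_space \<Rightarrow> 'a \<Rightarrow> 'a \<Rightarrow> 'a \<Rightarrow> real \<Rightarrow> bool" where
  "sep4_ge x y z w a \<longleftrightarrow>
     distinct [x, y, z, w] \<and>
     a \<le> dist x y \<and> a \<le> dist x z \<and> a \<le> dist x w \<and>
     a \<le> dist y z \<and> a \<le> dist y w \<and> a \<le> dist z w"

definition betweenness_witness ::
    "'a::metric_space set \<Rightarrow> real \<Rightarrow> real \<Rightarrow> real \<Rightarrow> real \<Rightarrow> bool" where
  "betweenness_witness X \<epsilon> a b \<theta> \<longleftrightarrow>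
     (\<forall>x\<in>X. \<forall>y\<in>X. \<forall>z\<in>X. \<forall>w\<in>X.
        sep4_ge x y z w a \<longrightarrow>
        diameter {x, y, z, w} \<le> b \<longrightarrow>
        dist x y + dist y z \<le> dist x z + \<theta> \<longrightarrow>
        dist y z + dist z w \<le> dist y w + \<theta> \<longrightarrow>
        dist x z + dist z w \<le> dist x w + \<epsilon>)"

definition uniform_betweenness :: "'a::metric_space set \<Rightarrow> bool" where
  "uniform_betweenness X \<longleftrightarrow>
     (\<forall>a>0. \<forall>b>0. \<forall>\<epsilon>>0. \<exists>\<theta>>0. betweenness_witness X \<epsilon> a b \<theta>)"

text \<open>A modulus is a function on \<open>(0,\<infinity>)\<^sup>3\<close>; the values of \<open>\<Theta>\<close> at other arguments are unconstrained.\<close>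

definition uniform_betweenness_modulus ::
    "'a::metric_space set \<Rightarrow> (real \<Rightarrow> real \<Rightarrow> real \<Rightarrow> real) \<Rightarrow> bool" where
  "uniform_betweenness_modulus X \<Theta> \<longleftrightarrow>
     (\<forall>\<epsilon>>0. \<forall>a>0. \<forall>b>0. \<Theta> \<epsilon> a b > 0 \<and> betweenness_witness X \<epsilon> a b (\<Theta> \<epsilon> a b))"

lemma uniform_betweenness_modulus_imp:
  "uniform_betweenness_modulus X \<Theta> \<Longrightarrow> uniform_betweenness X"
  unfolding uniform_betweenness_modulus_def uniform_betweenness_def by blast

definition lion_man_game ::
    "'a::metric_space set \<Rightarrow> real \<Rightarrow> (nat \<Rightarrow> 'a) \<Rightarrow> (nat \<Rightarrow> 'a) \<Rightarrow> bool" where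
  "lion_man_game X D M L \<longleftrightarrow>
     (\<forall>n. M n \<in> X \<and> L n \<in> X \<and>
        dist (M n) (M (Suc n)) \<le> D \<and>
        dist (L (Suc n)) (L n) + dist (L (Suc n)) (M n) = dist (L n) (M n) \<and>
        dist (L n) (L (Suc n)) = min D (dist (L n) (M n)))"

end

theory Submission imports Defs begin

text \<open>Write \<open>\<delta> i\<close> for \<open>d(L i, M i)\<close>. If the lion is still \<open>\<epsilon>\<close> away after \<open>n\<close> moves, then
  \<open>\<delta>\<close> is nonincreasing up to \<open>n\<close> and stays above \<open>D + \<epsilon>\<close>, so by pigeonhole it is almost
  constant along some window of \<open>N\<close> moves. There \<open>M i\<close> is almost between \<open>L (i+1)\<close> and
  \<open>M (i+1)\<close>, while \<open>L (i+1)\<close> lies between \<open>L i\<close> and \<open>M i\<close>; one use of betweenness shows that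
  consecutive lion positions are almost collinear. Further uses propagate this along
  the window, so the lion moves almost \<open>N D > b + 1\<close> away from its starting point, which is
  more than the diameter.\<close>

lemma betweennessD:
  assumes "betweenness_witness X \<epsilon> a b \<theta>" "bounded X" "diameter X \<le> b" "0 < a"
    and "x \<in> X" "y \<in> X" "z \<in> X" "w \<in> X"
    and "a \<le> dist x y" "a \<le> dist x z" "a \<le> dist x w" "a \<le> dist y z" "a \<le> dist y w" "a \<le> dist z w"
    and "dist x y + dist y z \<le> dist x z + \<theta>" "dist y z + dist z w \<le> dist y w + \<theta>"
  shows "dist x z + dist z w \<le> dist x w + \<epsilon>"
proof -
  have "diameter {x, y, z, w} \<le> b"
    using diameter_subset[of "{x, y, z, w}" X] assms by auto
  moreover have "sep4_ge x y z w a"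
    using assms by (auto simp: sep4_ge_def)
  ultimately show ?thesis
    using assms unfolding betweenness_witness_def by blast
qed

text \<open>Induction on k: betweenness at \<open>p 0\<close> and the three points from
  \<open>p (Suc k)\<close> on combines the induction hypothesis (error \<open>\<eta> k\<close>) with
  a local triple (error \<open>\<eta> 0\<close>) and worsens the error to
  \<open>\<eta> (Suc k)\<close>. The lower bound is carried along because it keeps
  \<open>p 0\<close> separated from the later points.\<close>

lemma almost_geodesic_chain:
  fixes p :: "nat \<Rightarrow> 'a::metric_space" and \<eta> :: "nat \<Rightarrow> real"
  assumes X: "bounded X" "diameter X \<le> b" "\<And>i. p i \<in> X"
    and wit: "\<And>k. k < K \<Longrightarrow> betweenness_witness X (\<eta> (Suc k)) (\<eta> (Suc k)) b (\<eta> k)"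
    and pos: "\<And>k. k \<le> K \<Longrightarrow> 0 < \<eta> k"
    and base: "\<And>k. k \<le> K \<Longrightarrow> \<eta> 0 \<le> \<eta> k"
    and le: "\<And>k. k \<le> K \<Longrightarrow> \<eta> k \<le> \<alpha>"
    and \<alpha>: "\<alpha> \<le> D / 2"
    and steps: "\<And>i. i \<le> Suc K \<Longrightarrow> dist (p i) (p (Suc i)) = D"
    and triples: "\<And>i. i \<le> K \<Longrightarrow> 2 * D \<le> dist (p i) (p (Suc (Suc i))) + \<eta> 0"
    and k: "k \<le> K"
  shows "real k * (D - \<alpha>) + D \<le> dist (p 0) (p (Suc k)) \<and>
    dist (p 0) (p (Suc k)) + D \<le> dist (p 0) (p (Suc (Suc k))) + \<eta> k"
  using k
proof (induction k)
  case 0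
  then show ?case using steps[of 0] triples[of 0] by simp
next
  case (Suc k)
  let ?q = "\<lambda>i. p (k + i)"
  note less = Suc.prems
  have IH: "real k * (D - \<alpha>) + D \<le> dist (p 0) (p (Suc k))"
    "dist (p 0) (p (Suc k)) + D \<le> dist (p 0) (p (Suc (Suc k))) + \<eta> k"
    using Suc by auto
  have \<alpha>0: "0 < \<alpha>" using pos[of 0] le[of 0] by simp
  have eta: "0 < \<eta> (Suc k)" "\<eta> (Suc k) \<le> \<alpha>" "\<eta> k \<le> \<alpha>" "\<eta> 0 \<le> \<eta> k" "\<eta> 0 \<le> \<alpha>"
    using pos[of "Suc k"] le[of "Suc k"] le[of k] base[of k] le[of 0] less by auto
  have nn: "0 \<le> real k * (D - \<alpha>)"
    using \<alpha> \<alpha>0 by simp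
  have lower: "real (Suc k) * (D - \<alpha>) + D \<le> dist (p 0) (p (Suc (Suc k)))"
    using IH eta by (simp add: algebra_simps)
  have d12: "dist (p (Suc k)) (p (Suc (Suc k))) = D"
    and d23: "dist (p (Suc (Suc k))) (p (Suc (Suc (Suc k)))) = D"
    using steps less by auto
  have d13: "2 * D \<le> dist (p (Suc k)) (p (Suc (Suc (Suc k)))) + \<eta> 0"
    using triples less by auto
  \<comment> \<open>Even if the last step went straight back, a distance of at least D - \<alpha>
    \<ge> \<alpha> from \<open>p 0\<close> would remain, which is separation enough.\<close>
  have d03: "real (Suc k) * (D - \<alpha>) \<le> dist (p 0) (p (Suc (Suc (Suc k))))"
    using lower d23 dist_triangle[of "p 0" "p (Suc (Suc k))" "p (Suc (Suc (Suc k)))"]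
    by (simp add: dist_commute)
  have "real (Suc k) * (D - \<alpha>) = real k * (D - \<alpha>) + (D - \<alpha>)"
    by (simp add: algebra_simps)
  note far = this nn lower IH d12 d23 d13 d03
  have "dist (p 0) (p (Suc (Suc k))) + dist (p (Suc (Suc k))) (p (Suc (Suc (Suc k))))
      \<le> dist (p 0) (p (Suc (Suc (Suc k)))) + \<eta> (Suc k)"
    by (rule betweennessD[OF wit X(1,2) eta(1), where y = "p (Suc k)"])
      (use X(3) less in simp_all, use far eta \<alpha> \<alpha>0 in linarith)+
  with lower d23 show ?case by simp
qed

text \<open>The K + 1 consecutive windows of length N telescope: a loss of at least \<theta> in each
  would add up to (K + 1) * \<theta>.\<close>

lemma exists_window_small_decrease:
  fixes f :: "nat \<Rightarrow> real"
  assumes "f 0 - f (N + N * K) < (real K + 1) * \<theta>"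
  shows "\<exists>k\<le>K. f (N * k) - f (N * k + N) < \<theta>"
  using assms
proof (induction K)
  case (Suc K)
  show ?case
  proof (cases "f (N * Suc K) - f (N * Suc K + N) < \<theta>")
    case False
    then have "f 0 - f (N + N * K) < (real K + 1) * \<theta>"
      using Suc.prems by (simp add: algebra_simps)
    then show ?thesis using Suc.IH le_Suc_eq by blast
  qed blast
qed simp

lemma funpow_below_self:
  fixes f :: "real \<Rightarrow> real"
  assumes f: "\<And>x. 0 < x \<Longrightarrow> 0 < f x \<and> f x \<le> x" and x: "0 < x"
  shows "0 < (f ^^ j) x" "(f ^^ (i + j)) x \<le> (f ^^ j) x"
proof -
  show pos: "0 < (f ^^ j) x" for j
    by (induction j) (use f x in auto)
  show "(f ^^ (i + j)) x \<le> (f ^^ j) x"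
    by (induction i) (use f[OF pos] in \<open>auto intro: order_trans\<close>)
qed

context
  fixes X :: "'a::metric_space set" and D :: real and M L :: "nat \<Rightarrow> 'a"
  assumes game: "lion_man_game X D M L"
begin

lemma game_dist_lion_man:
  "dist (L (Suc n)) (M n) = dist (L n) (M n) - min D (dist (L n) (M n))"
  using game unfolding lion_man_game_def by (smt (verit) dist_commute)

text \<open>Beyond D, the man can at best regain what the lion gains. Within D, the lion lands on
  the man's old position and the distance may grow again, but only up to D; hence the
  truncation.\<close>

lemma decseq_max_speed_dist: "decseq (\<lambda>n. max D (dist (L n) (M n)))"
proof (rule decseq_SucI)
  fix n
  have "dist (L (Suc n)) (M (Suc n)) \<le> dist (L (Suc n)) (M n) + dist (M n) (M (Suc n))"
    by (rule dist_triangle)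
  moreover have "dist (M n) (M (Suc n)) \<le> D"
    using game unfolding lion_man_game_def by blast
  ultimately show "max D (dist (L (Suc n)) (M (Suc n))) \<le> max D (dist (L n) (M n))"
    using game_dist_lion_man[of n] by linarith
qed

text \<open>At time n a full move D leaves at least \<epsilon>, so the truncated distance exceeds D
  there and, by monotonicity, at all earlier times; above D it is the distance itself.\<close>

lemma game_distance_lower:
  assumes "0 < \<epsilon>" "\<epsilon> \<le> dist (L (Suc n)) (M n)" "i \<le> n"
  shows "D + \<epsilon> \<le> dist (L i) (M i)"
  using decseqD[OF decseq_max_speed_dist assms(3)] game_dist_lion_man[of n] assms by linarith

lemma game_distance_antimono:
  assumes "0 < \<epsilon>" "\<epsilon> \<le> dist (L (Suc n)) (M n)" "i \<le> j" "j \<le> n"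
  shows "dist (L j) (M j) \<le> dist (L i) (M i)"
  using decseqD[OF decseq_max_speed_dist assms(3)] assms
    game_distance_lower[OF assms(1,2), of i] game_distance_lower[OF assms(1,2), of j] by simp

lemma lion_triple_almost_geodesic:
  assumes X: "bounded X" "diameter X \<le> b"
    and wit: "betweenness_witness X \<eta> \<eta> b \<theta>"
    and \<eta>: "0 < \<eta>" "\<eta> \<le> \<epsilon>" "\<eta> \<le> D / 2" and \<theta>: "0 \<le> \<theta>" "\<theta> \<le> D / 2"
    and far: "D + \<epsilon> \<le> dist (L i) (M i)" "D + \<epsilon> \<le> dist (L (Suc i)) (M (Suc i))"
    and decrease: "dist (L i) (M i) - dist (L (Suc i)) (M (Suc i)) \<le> \<theta>"
  shows "2 * D \<le> dist (L i) (L (Suc (Suc i))) + \<eta>"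
proof -
  have inX: "M n \<in> X" "L n \<in> X" for n
    using game unfolding lion_man_game_def by auto
  have LL: "dist (L i) (L (Suc i)) = D"
    using game far \<eta> unfolding lion_man_game_def by (smt (verit))
  have LM: "dist (L (Suc i)) (M i) = dist (L i) (M i) - D"
      "dist (L (Suc (Suc i))) (M (Suc i)) = dist (L (Suc i)) (M (Suc i)) - D"
    using game_dist_lion_man[of i] game_dist_lion_man[of "Suc i"] far \<eta> by simp_all
  have MM: "dist (M i) (M (Suc i)) \<le> D"
    using game unfolding lion_man_game_def by blast
  have tri: "dist (L (Suc i)) (M (Suc i)) \<le> dist (L (Suc i)) (M i) + dist (M i) (M (Suc i))"
      "dist (L i) (M i) \<le> dist (L i) (M (Suc i)) + dist (M i) (M (Suc i))"
      "dist (L i) (M (Suc i)) \<le> dist (L i) (L (Suc (Suc i))) + dist (L (Suc (Suc i))) (M (Suc i))"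
    by (rule dist_triangle dist_triangle2)+
  note facts = LL LM MM tri far decrease \<eta> \<theta>
  \<comment> \<open>\<open>L (Suc i)\<close> is exactly between \<open>L i\<close> and
    \<open>M i\<close>. \<open>M i\<close> is between \<open>L (Suc i)\<close> and
    \<open>M (Suc i)\<close> up to \<theta>, as the man moves at most D and the distance drops by at
    most \<theta>. With \<theta> \<le> D / 2 the man moves at least D / 2, which separates
    \<open>M i\<close> from \<open>M (Suc i)\<close>.\<close>
  have "dist (L i) (M i) + dist (M i) (M (Suc i)) \<le> dist (L i) (M (Suc i)) + \<eta>"
    by (rule betweennessD[OF wit X \<eta>(1), where y = "L (Suc i)"])
      (use inX in simp_all, use facts in linarith)+
  \<comment> \<open>The first inequality of \<open>tri\<close> bounds the man's move from below, the
    third goes from \<open>L i\<close> to \<open>M (Suc i)\<close> via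
    \<open>L (Suc (Suc i))\<close>; the distances to the man cancel.\<close>
  with facts show ?thesis by linarith
qed

end

theorem corollary2p8:
  fixes X :: "'a::metric_space set"
    and \<Theta> :: "real \<Rightarrow> real \<Rightarrow> real \<Rightarrow> real"
    and \<Theta>\<^sub>b :: "real \<Rightarrow> real"
    and b D :: real
    and N :: nat
    and M L :: "nat \<Rightarrow> 'a"
  defines "\<Theta>\<^sub>b \<equiv> \<lambda>\<epsilon>. \<Theta> \<epsilon> \<epsilon> b"
  assumes "uniform_betweenness_modulus X \<Theta>"
    and "bounded X" and "diameter X > 0" and "b \<ge> diameter X"
    and "D > 0"
    and "b + 1 < real N * D"
    and "\<forall>\<epsilon>>0. \<Theta>\<^sub>b \<epsilon> \<le> \<epsilon>"
    and "lion_man_game X D M L"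
  shows "\<forall>\<epsilon>>0. \<forall>\<alpha>. 0 < \<alpha> \<and> \<alpha> \<le> Min {1 / real N, \<epsilon> / 2, D / 2} \<longrightarrow>
           (\<forall>n::nat. int n \<ge> int N + int N * \<lceil>b / (\<Theta>\<^sub>b ^^ N) \<alpha>\<rceil> \<longrightarrow>
              dist (L (Suc n)) (M n) < \<epsilon>)"
proof (intro allI impI, rule ccontr)
  fix \<epsilon> \<alpha> :: real and n :: nat
  assume \<epsilon>: "0 < \<epsilon>" and \<alpha>: "0 < \<alpha> \<and> \<alpha> \<le> Min {1 / real N, \<epsilon> / 2, D / 2}"
    and n: "int N + int N * \<lceil>b / (\<Theta>\<^sub>b ^^ N) \<alpha>\<rceil> \<le> int n"
    and "\<not> dist (L (Suc n)) (M n) < \<epsilon>"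
  note X = assms(3) assms(5) and game = assms(9)
  from \<open>\<not> _\<close> have not_caught: "\<epsilon> \<le> dist (L (Suc n)) (M n)" by simp
  have \<alpha>_le: "0 < \<alpha>" "\<alpha> \<le> 1 / real N" "\<alpha> \<le> \<epsilon> / 2" "\<alpha> \<le> D / 2"
    using \<alpha> by auto
  have inX: "M i \<in> X" "L i \<in> X" for i
    using game unfolding lion_man_game_def by auto
  have dist_le: "dist x y \<le> b" if "x \<in> X" "y \<in> X" for x y
    using diameter_bounded_bound[OF X(1) that] X(2) by simp
  have b: "0 < b" using assms(4,5) by simp
  have far: "D + \<epsilon> \<le> dist (L i) (M i)" if "i \<le> n" for i
    using game_distance_lower[OF game \<epsilon> not_caught that] .
  have "D < b"
    using far[of n] dist_le[OF inX(2,1), of n n] \<epsilon> by simp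
  have N2: "2 \<le> N"
  proof (rule ccontr)
    assume "\<not> 2 \<le> N"
    then have "N = 0 \<or> N = 1" by auto
    with assms(7) \<open>D < b\<close> b show False by auto
  qed
  have step: "0 < \<Theta>\<^sub>b \<epsilon> \<and> \<Theta>\<^sub>b \<epsilon> \<le> \<epsilon>"
    and witness: "betweenness_witness X \<epsilon> \<epsilon> b (\<Theta>\<^sub>b \<epsilon>)" if "0 < \<epsilon>" for \<epsilon>
    using assms(2,8) b that unfolding \<Theta>\<^sub>b_def uniform_betweenness_modulus_def by auto
  \<comment> \<open>The error budget, spent from index N downwards: \<open>\<eta> N\<close> bounds
    the decrease over the window, \<open>\<eta> (N - 1)\<close> the error of lion triples, and N - 2
    chain steps end at \<open>\<eta> 1\<close> \<le> \<alpha>.\<close>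
  define \<eta> where "\<eta> j = (\<Theta>\<^sub>b ^^ j) \<alpha>" for j
  have \<eta>_pos: "0 < \<eta> j" and \<eta>_anti: "i \<le> j \<Longrightarrow> \<eta> j \<le> \<eta> i" for i j
    unfolding \<eta>_def using funpow_below_self[of \<Theta>\<^sub>b \<alpha>, OF step \<alpha>_le(1)]
    by (metis le_add_diff_inverse2)+
  have \<eta>_le: "\<eta> j \<le> \<alpha>" for j
    using \<eta>_anti[of 0 j] by (simp add: \<eta>_def)
  have \<eta>_wit: "betweenness_witness X (\<eta> j) (\<eta> j) b (\<eta> (Suc j))" for j
    using witness[OF \<eta>_pos[of j]] by (simp add: \<eta>_def)

  define K where "K = nat \<lceil>b / \<eta> N\<rceil>"
  \<comment> \<open>Positivity ensures that \<open>nat\<close> does not truncate the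
    ceiling.\<close>
  have "0 < b / \<eta> N" using b \<eta>_pos by simp
  then have K: "int K = \<lceil>b / \<eta> N\<rceil>" "b / \<eta> N \<le> real K"
    unfolding K_def by linarith+
  have nK: "N + N * K \<le> n"
    using n unfolding \<eta>_def[symmetric] K(1)[symmetric] by (metis of_nat_add of_nat_mult of_nat_le_iff)
  let ?\<delta> = "\<lambda>i. dist (L i) (M i)"
  have "?\<delta> 0 - ?\<delta> (N + N * K) < b"
    using dist_le[OF inX(2,1), of 0 0] far[OF nK] \<epsilon> assms(6) by linarith
  also have "b \<le> (real K + 1) * \<eta> N"
    using K(2) \<eta>_pos[of N] by (simp add: field_simps)
  finally obtain k where k: "k \<le> K" "?\<delta> (N * k) - ?\<delta> (N * k + N) < \<eta> N"
    using exists_window_small_decrease[of ?\<delta>] by blast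
  define m where "m = N * k"
  have "m \<le> N * K" using k(1) by (simp add: m_def)
  with nK have m: "m + N \<le> n" by simp

  have triples: "2 * D \<le> dist (L (m + i)) (L (Suc (Suc (m + i)))) + \<eta> (N - 1)" if "i < N" for i
  proof (rule lion_triple_almost_geodesic[OF game X, where \<epsilon> = \<epsilon>])
    show "betweenness_witness X (\<eta> (N - 1)) (\<eta> (N - 1)) b (\<eta> N)"
      using \<eta>_wit[of "N - 1"] N2 by simp
    \<comment> \<open>By monotonicity a single move loses no more than the whole window.\<close>
    show "?\<delta> (m + i) - ?\<delta> (Suc (m + i)) \<le> \<eta> N"
      using game_distance_antimono[OF game \<epsilon> not_caught, of m "m + i"]
        game_distance_antimono[OF game \<epsilon> not_caught, of "Suc (m + i)" "m + N"]
        k(2) m that by (simp add: m_def)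
  qed (use far m that \<eta>_pos[of "N - 1"] \<eta>_pos[of N] \<eta>_le[of "N - 1"] \<eta>_le[of N] \<alpha>_le in auto)
  have steps: "dist (L (m + i)) (L (Suc (m + i))) = D" if "i < N" for i
    using game far[of "m + i"] m that \<epsilon> unfolding lion_man_game_def by auto

  \<comment> \<open>The chain lemma wants errors that grow with k, hence the reversed index N - 1 -
    k.\<close>
  have "real (N - 2) * (D - \<alpha>) + D \<le> dist (L (m + 0)) (L (m + Suc (N - 2))) \<and>
    dist (L (m + 0)) (L (m + Suc (N - 2))) + D
      \<le> dist (L (m + 0)) (L (m + Suc (Suc (N - 2)))) + \<eta> (N - 1 - (N - 2))"
  proof (rule almost_geodesic_chain[where p = "\<lambda>i. L (m + i)" and \<eta> = "\<lambda>k. \<eta> (N - 1 - k)"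
        and K = "N - 2", OF X])
    show "betweenness_witness X (\<eta> (N - 1 - Suc k)) (\<eta> (N - 1 - Suc k)) b (\<eta> (N - 1 - k))"
      if "k < N - 2" for k
      using \<eta>_wit[of "N - 1 - Suc k"] that by (simp add: Suc_diff_Suc numeral_2_eq_2)
  qed (use inX \<eta>_pos \<eta>_le \<eta>_anti \<alpha>_le steps triples N2 in auto)
  \<comment> \<open>The total loss against N * D is (N - 1) * \<alpha>, which is below 1 because
    \<alpha> \<le> 1 / N.\<close>
  then have "real (N - 2) * (D - \<alpha>) + 2 * D \<le> dist (L m) (L (m + N)) + \<alpha>"
    using \<eta>_le[of "N - 1 - (N - 2)"] N2 by (simp add: numeral_2_eq_2 Suc_diff_Suc)
  moreover have "real (N - 2) = real N - 2" using N2 by simp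
  moreover have "real N * \<alpha> \<le> 1"
    using \<alpha>_le(2) N2 by (simp add: field_simps)
  ultimately have "real N * D - 1 \<le> dist (L m) (L (m + N))"
    using \<alpha>_le(1) by (simp add: algebra_simps)
  with dist_le[OF inX(2) inX(2), of m "m + N"] assms(7) show False
    by linarith
qed

end
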